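(* Let $\mathcal{C}$ be the convex cone of quasiconvex quadratic forms on $\mathbb{R}^{3\times 3}$ with linear elastic orthotropic symmetry. Let $Q\in\mathcal{C}$ be given, for $\xi=(\xi_{ij})\in\mathbb{R}^{3\times 3}$, by $$Q(\xi)=\sum_{i,j=1}^3 C_{ij}\,\xi_{ii}\xi_{jj}+C_{44}(\xi_{23}+\xi_{32})^2+C_{55}(\xi_{13}+\xi_{31})^2+C_{66}(\xi_{12}+\xi_{21})^2,$$ with real coefficients satisfying $C_{ij}=C_{ji}$ for $i,j\in\{1,2,3\}$, and assume that $$C_{ii}>0\quad\text{for } i=1,2,\dots,6.$$ Let $T(y)$ be the acoustic matrix of $Q$. If the polynomial $y\mapsto\det(T(y))$, $y\in\mathbb{R}^3$, is an extremal polynomial, then $Q$ is an extreme point of $\mathcal{C}$.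
   Context: For $x,y\in\mathbb{R}^3$, $x\otimes y\in\mathbb{R}^{3\times3}$ is the matrix with entries $(x\otimes y)_{ij}=x_iy_j$. Quasiconvexity: a quadratic form $f:\mathbb{R}^{3\times 3}\to\mathbb{R}$ is quasiconvex if and only if $f(x\otimes y)\ge 0$ for all $x,y\in\mathbb{R}^3$ (for quadratic forms this is equivalent to the usual definition of quasiconvexity). Orthotropic symmetry: a quadratic form on $\mathbb{R}^{3\times3}$ has linear elastic orthotropic symmetry if it is of the form $$\sum_{i,j=1}^3 C_{ij}\,\xi_{ii}\xi_{jj}+C_{44}(\xi_{23}+\xi_{32})^2+C_{55}(\xi_{13}+\xi_{31})^2+C_{66}(\xi_{12}+\xi_{21})^2$$ for some real constants $C_{ij}=C_{ji}$ ($1\le i,j\le 3$), $C_{44},C_{55},C_{66}$. The cone $\mathcal{C}$ consists of all quadratic forms of this type that are quasiconvex. Acoustic matrix: $T(y)$ is the symmetric $3\times 3$ matrix, with entries that are quadratic forms in $y\in\mathbb{R}^3$, determined by $Q(x\otimes y)=x\,T(y)\,x^T$ for all (row vectors) $x,y\in\mathbb{R}^3$. Its determinant is a homogeneous polynomial of degree $6$ in $y$, nonnegative on $\mathbb{R}^3$ when $Q$ is quasiconvex. Extremal polynomial: a nonnegative homogeneous polynomial $P$ (real coefficients, in $y\in\mathbb{R}^3$) is extremal if, whenever $R$ is a homogeneous polynomial of the same degree with $0\le R(y)\le P(y)$ for all $y\in\mathbb{R}^3$, $R$ is a scalar multiple of $P$. Extreme point of $\mathcal{C}$ (in the convex-analysis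 sense for cones, i.e. a generator of an extreme ray): $Q\in\mathcal{C}$ is an extreme point of $\mathcal{C}$ if, whenever $Q_1\in\mathcal{C}$ satisfies $0\le Q_1(x\otimes y)\le Q(x\otimes y)$ for all $x,y\in\mathbb{R}^3$, one has $Q_1=\alpha Q$ for some $\alpha\in[0,1]$. *)

theory Defs
  imports "HOL-Analysis.Analysis"
begin

definition tensor :: "real^3 \<Rightarrow> real^3 \<Rightarrow> real^3^3"  (infixl "\<otimes>\<^sub>t" 70)
  where "x \<otimes>\<^sub>t y = (\<chi> i j. x $ i * y $ j)"

definition quadratic_form :: "('a::real_vector \<Rightarrow> real) \<Rightarrow> bool"
  where "quadratic_form f \<longleftrightarrow> (\<exists>B. bilinear B \<and> (\<forall>x. f x = B x x))"

text \<open>For quadratic forms, quasiconvexity means nonnegativity on rank-one matrices.\<close>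

definition quasiconvex_form :: "(real^3^3 \<Rightarrow> real) \<Rightarrow> bool"
  where "quasiconvex_form f \<longleftrightarrow> quadratic_form f \<and> (\<forall>x y. f (x \<otimes>\<^sub>t y) \<ge> 0)"

definition orthotropic_form ::
    "real^3^3 \<Rightarrow> real \<Rightarrow> real \<Rightarrow> real \<Rightarrow> real^3^3 \<Rightarrow> real"
  where "orthotropic_form C c44 c55 c66 \<xi> =
    (\<Sum>i\<in>UNIV. \<Sum>j\<in>UNIV. C $ i $ j * \<xi> $ i $ i * \<xi> $ j $ j)
    + c44 * (\<xi> $ 2 $ 3 + \<xi> $ 3 $ 2)\<^sup>2
    + c55 * (\<xi> $ 1 $ 3 + \<xi> $ 3 $ 1)\<^sup>2
    + c66 * (\<xi> $ 1 $ 2 + \<xi> $ 2 $ 1)\<^sup>2"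

definition orthotropic :: "(real^3^3 \<Rightarrow> real) \<Rightarrow> bool"
  where "orthotropic f \<longleftrightarrow>
    (\<exists>C c44 c55 c66. (\<forall>i j. C $ i $ j = C $ j $ i) \<and> f = orthotropic_form C c44 c55 c66)"

definition orthotropic_cone :: "(real^3^3 \<Rightarrow> real) set"
  where "orthotropic_cone = {f. orthotropic f \<and> quasiconvex_form f}"

definition cone_extreme_point :: "(real^3^3 \<Rightarrow> real) \<Rightarrow> bool"
  where "cone_extreme_point Q \<longleftrightarrow> Q \<in> orthotropic_cone \<and>
    (\<forall>Q1\<in>orthotropic_cone.
      (\<forall>x y. 0 \<le> Q1 (x \<otimes>\<^sub>t y) \<and> Q1 (x \<otimes>\<^sub>t y) \<le> Q (x \<otimes>\<^sub>t y)) \<longrightarrow>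
      (\<exists>\<alpha>\<in>{0..1}. \<forall>\<xi>. Q1 \<xi> = \<alpha> * Q \<xi>))"

definition is_acoustic_matrix :: "(real^3^3 \<Rightarrow> real) \<Rightarrow> (real^3 \<Rightarrow> real^3^3) \<Rightarrow> bool"
  where "is_acoustic_matrix Q T \<longleftrightarrow>
    (\<forall>y. transpose (T y) = T y) \<and>
    (\<forall>i j. quadratic_form (\<lambda>y. T y $ i $ j)) \<and>
    (\<forall>x y. Q (x \<otimes>\<^sub>t y) = (x v* T y) \<bullet> x)"

text \<open>A homogeneous polynomial is represented by its polynomial function.  The sum runs over all
  exponent vectors \<open>m\<close> of total degree \<open>d\<close>, of which there are finitely many.\<close>

definition homogeneous_polynomial :: "nat \<Rightarrow> (real^'n \<Rightarrow> real) \<Rightarrow> bool"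
  where "homogeneous_polynomial d P \<longleftrightarrow>
    (\<exists>a :: ('n \<Rightarrow> nat) \<Rightarrow> real. \<forall>y.
      P y = (\<Sum>m | (\<Sum>i\<in>UNIV. m i) = d. a m * (\<Prod>i\<in>UNIV. y $ i ^ m i)))"

definition extremal_polynomial :: "nat \<Rightarrow> (real^'n \<Rightarrow> real) \<Rightarrow> bool"
  where "extremal_polynomial d P \<longleftrightarrow>
    homogeneous_polynomial d P \<and> (\<forall>y. 0 \<le> P y) \<and>
    (\<forall>R. homogeneous_polynomial d R \<and> (\<forall>y. 0 \<le> R y \<and> R y \<le> P y) \<longrightarrow>
      (\<exists>c. \<forall>y. R y = c * P y))"

lemma finite_exponents: "finite {m :: 'n::finite \<Rightarrow> nat. (\<Sum>i\<in>UNIV. m i) = d}"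
proof (rule finite_subset)
  show "{m. (\<Sum>i\<in>UNIV. m i) = d} \<subseteq> Pi\<^sub>E (UNIV :: 'n set) (\<lambda>_. {..d})"
    by (auto simp: PiE_def extensional_def intro: member_le_sum)
  show "finite (Pi\<^sub>E (UNIV :: 'n set) (\<lambda>_. {..d}))"
    by (rule finite_PiE) auto
qed

lemma quadratic_form_prod:
  assumes "linear f" "linear g"
  shows "quadratic_form (\<lambda>x. f x * g x :: real)"
  unfolding quadratic_form_def bilinear_def
  using assms by (intro exI[of _ "\<lambda>x y. f x * g y"])
    (auto simp: linear_iff algebra_simps)

lemma quadratic_form_add:
  assumes "quadratic_form f" "quadratic_form g"
  shows "quadratic_form (\<lambda>x. f x + g x)"
proof -
  obtain A B where "bilinear A" "\<And>x. f x = A x x" "bilinear B" "\<And>x. g x = B x x"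
    using assms unfolding quadratic_form_def by blast
  then show ?thesis
    unfolding quadratic_form_def
    by (intro exI[of _ "\<lambda>x y. A x y + B x y"])
      (auto simp: bilinear_def intro: linear_compose_add)
qed

lemma quadratic_form_sum:
  fixes f :: "'i \<Rightarrow> 'a::real_vector \<Rightarrow> real"
  assumes "finite I" "\<And>i. i \<in> I \<Longrightarrow> quadratic_form (f i)"
  shows "quadratic_form (\<lambda>x. \<Sum>i\<in>I. f i x)"
  using assms
proof (induction I rule: finite_induct)
  case empty
  have "quadratic_form (\<lambda>x::'a. (0::real) * 0)"
    by (rule quadratic_form_prod) (auto simp: linear_iff)
  then show ?case by simp
next
  case (insert i I)
  then show ?case by (simp add: quadratic_form_add)
qed

lemma orthotropic_form_quadratic: "quadratic_form (orthotropic_form C c44 c55 c66)"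
proof -
  have "quadratic_form (\<lambda>\<xi>::real^3^3.
      (\<Sum>i\<in>UNIV. \<Sum>j\<in>UNIV. (C $ i $ j * \<xi> $ i $ i) * \<xi> $ j $ j)
      + (c44 * (\<xi> $ 2 $ 3 + \<xi> $ 3 $ 2)) * (\<xi> $ 2 $ 3 + \<xi> $ 3 $ 2)
      + (c55 * (\<xi> $ 1 $ 3 + \<xi> $ 3 $ 1)) * (\<xi> $ 1 $ 3 + \<xi> $ 3 $ 1)
      + (c66 * (\<xi> $ 1 $ 2 + \<xi> $ 2 $ 1)) * (\<xi> $ 1 $ 2 + \<xi> $ 2 $ 1))"
    by (intro quadratic_form_add quadratic_form_sum quadratic_form_prod)
      (auto simp: linear_iff algebra_simps)
  then show ?thesis
    by (simp add: orthotropic_form_def[abs_def] power2_eq_square mult.assoc)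
qed

lemma acoustic_matrix_unique:
  assumes "is_acoustic_matrix Q S" "is_acoustic_matrix Q T"
  shows "S = T"
proof
  fix y
  define A where "A = S y - T y"
  have sym: "A $ i $ j = A $ j $ i" for i j
    using assms unfolding is_acoustic_matrix_def A_def transpose_def
    by (metis (no_types, lifting) vec_lambda_beta vector_minus_component)
  have "(x v* S y) \<bullet> x = (x v* T y) \<bullet> x" for x
    using assms unfolding is_acoustic_matrix_def by metis
  then have q: "(\<Sum>i\<in>UNIV. \<Sum>j\<in>UNIV. A $ i $ j * x $ i * x $ j) = 0" for x :: "real^3"
    unfolding A_def inner_vec_def vector_matrix_mult_def
    by (simp add: sum_3 algebra_simps)
  have "A $ i $ j = 0" for i j
    using q[of "axis i 1 + axis j 1"] q[of "axis i 1"] q[of "axis j 1"] sym[of 1 2] sym[of 1 3] sym[of 2 3]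
      exhaust_3[of i] exhaust_3[of j]
    by (auto simp: sum_3 axis_def)
  then show "S y = T y"
    by (simp add: A_def vec_eq_iff)
qed

lemma acoustic_matrix_exists:
  assumes "\<And>i j. C $ i $ j = C $ j $ i"
  shows "\<exists>T. is_acoustic_matrix (orthotropic_form C c44 c55 c66) T"
proof -
  define T :: "real^3 \<Rightarrow> real^3^3" where "T y = vector [
      vector [C$1$1 * y$1 * y$1 + c66 * y$2 * y$2 + c55 * y$3 * y$3,
              (C$1$2 + c66) * y$1 * y$2, (C$1$3 + c55) * y$1 * y$3],
      vector [(C$1$2 + c66) * y$1 * y$2,
              c66 * y$1 * y$1 + C$2$2 * y$2 * y$2 + c44 * y$3 * y$3, (C$2$3 + c44) * y$2 * y$3],
      vector [(C$1$3 + c55) * y$1 * y$3, (C$2$3 + c44) * y$2 * y$3,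
              c55 * y$1 * y$1 + c44 * y$2 * y$2 + C$3$3 * y$3 * y$3]]" for y
  have "quadratic_form (\<lambda>y. T y $ i $ j)" for i j
    using exhaust_3[of i] exhaust_3[of j]
    by (auto simp: T_def intro!: quadratic_form_add quadratic_form_prod)
      (auto simp: linear_iff algebra_simps)
  moreover have "transpose (T y) = T y" for y
    by (simp add: T_def transpose_def vec_eq_iff forall_3)
  moreover have "orthotropic_form C c44 c55 c66 (x \<otimes>\<^sub>t y) = (x v* T y) \<bullet> x" for x y
    using assms[of 2 1] assms[of 3 1] assms[of 3 2]
    by (simp add: T_def orthotropic_form_def tensor_def vector_matrix_mult_def inner_vec_def sum_3
        power2_eq_square algebra_simps)
  ultimately show ?thesis
    unfolding is_acoustic_matrix_def by blast
qed

end

theory Submission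
  imports Defs
begin

text \<open>
  Let \<open>T\<close> be the acoustic matrix of \<open>Q\<close>, and let \<open>T\<^sub>1\<close> be that of a form \<open>Q\<^sub>1\<close> of the cone with
  \<open>0 \<le> Q\<^sub>1 \<le> Q\<close> on rank-one matrices, so that \<open>0 \<le> T\<^sub>1(y) \<le> T(y)\<close> as symmetric matrices for every
  \<open>y\<close>.  For \<open>0 \<le> t \<le> 1\<close> the sextic \<open>det (T - t T\<^sub>1)\<close> then lies between \<open>0\<close> and \<open>det T\<close>, because the
  determinant is monotone on positive semidefinite matrices (\<open>det3_mono\<close>).  Extremality makes it a
  multiple of \<open>det T\<close>, and since everything is cubic in the pencil parameter, the generalised
  eigenvalues of \<open>T\<^sub>1(y)\<close> relative to \<open>T(y)\<close> do not depend on \<open>y\<close> (\<open>spectrum_constant\<close>).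

  On a coordinate plane, such as \<open>y\<^sub>3 = 0\<close>, the acoustic matrices split into a scalar and a
  \<open>2 \<times> 2\<close> block.  The scalar quotient \<open>(d\<^sub>5\<^sub>5 y\<^sub>1\<^sup>2 + d\<^sub>4\<^sub>4 y\<^sub>2\<^sup>2) / (c\<^sub>5\<^sub>5 y\<^sub>1\<^sup>2 + c\<^sub>4\<^sub>4 y\<^sub>2\<^sup>2)\<close> is one of the three
  constant eigenvalues, hence is itself constant.  So the shear coefficients of \<open>Q\<^sub>1\<close> are a common
  multiple \<open>\<mu>\<close> of those of \<open>Q\<close>; comparing the three coordinate axes, the diagonal coefficients are
  a common multiple \<open>\<alpha>\<close>, and the spectrum is \<open>\<alpha>, \<mu>, \<mu>\<close> (\<open>two_eigenvalues\<close>).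

  If \<open>\<alpha> = \<mu>\<close>, the symmetric matrix \<open>T\<^sub>1 - \<mu> T\<close> has only zero eigenvalues relative to \<open>T\<close>, so it
  vanishes and \<open>Q\<^sub>1 = \<alpha> Q\<close>.  If \<open>\<alpha> \<noteq> \<mu>\<close>, then \<open>T\<^sub>1 - \<mu> T\<close> is \<open>\<alpha> - \<mu>\<close> times a matrix of rank one
  (\<open>eigenvalue_blocks\<close>), and this forces
  \<open>Q(x \<otimes> y) = (\<Sum>\<^sub>i m\<^sub>i x\<^sub>i y\<^sub>i)\<^sup>2 + c\<^sub>6\<^sub>6 (x\<^sub>1 y\<^sub>2 \<plusminus> x\<^sub>2 y\<^sub>1)\<^sup>2 + c\<^sub>5\<^sub>5 (x\<^sub>1 y\<^sub>3 \<plusminus> x\<^sub>3 y\<^sub>1)\<^sup>2 + c\<^sub>4\<^sub>4 (x\<^sub>2 y\<^sub>3 \<plusminus> x\<^sub>3 y\<^sub>2)\<^sup>2\<close>.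
  The summand with \<open>c\<^sub>6\<^sub>6\<close> is then itself a form of the cone below \<open>Q\<close>, but its shear coefficients
  \<open>0, 0, c\<^sub>6\<^sub>6\<close> are not a common multiple of \<open>c\<^sub>4\<^sub>4, c\<^sub>5\<^sub>5, c\<^sub>6\<^sub>6\<close>: a contradiction
  (\<open>no_rank_one_splitting\<close>).
\<close>

section \<open>Homogeneous polynomials\<close>

lemma homogeneous_monomial:
  assumes "(\<Sum>i\<in>UNIV. m i) = d"
  shows "homogeneous_polynomial d (\<lambda>y::real^'n::finite. \<Prod>i\<in>UNIV. y $ i ^ m i)"
  unfolding homogeneous_polynomial_def
  by (intro exI[of _ "\<lambda>m'. if m' = m then 1 else 0"])
    (simp add: assms finite_exponents if_distrib[of "\<lambda>x. x * _"] cong: if_cong)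

lemma homogeneous_add:
  assumes "homogeneous_polynomial d P" "homogeneous_polynomial d R"
  shows "homogeneous_polynomial d (\<lambda>y. P y + R y)"
proof -
  obtain a b where
    "\<And>y. P y = (\<Sum>m | (\<Sum>i\<in>UNIV. m i) = d. a m * (\<Prod>i\<in>UNIV. y $ i ^ m i))"
    "\<And>y. R y = (\<Sum>m | (\<Sum>i\<in>UNIV. m i) = d. b m * (\<Prod>i\<in>UNIV. y $ i ^ m i))"
    using assms unfolding homogeneous_polynomial_def by blast
  then show ?thesis
    unfolding homogeneous_polynomial_def
    by (intro exI[of _ "\<lambda>m. a m + b m"]) (simp add: sum.distrib distrib_right)
qed

lemma homogeneous_scale:
  assumes "homogeneous_polynomial d P"
  shows "homogeneous_polynomial d (\<lambda>y. c * P y)"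
proof -
  obtain a where
    "\<And>y. P y = (\<Sum>m | (\<Sum>i\<in>UNIV. m i) = d. a m * (\<Prod>i\<in>UNIV. y $ i ^ m i))"
    using assms unfolding homogeneous_polynomial_def by blast
  then show ?thesis
    unfolding homogeneous_polynomial_def
    by (intro exI[of _ "\<lambda>m. c * a m"]) (simp add: sum_distrib_left mult.assoc)
qed

lemma homogeneous_diff:
  assumes "homogeneous_polynomial d P" "homogeneous_polynomial d R"
  shows "homogeneous_polynomial d (\<lambda>y. P y - R y)"
  using homogeneous_add[OF assms(1) homogeneous_scale[OF assms(2), of "-1"]] by simp

lemma homogeneous_sum:
  assumes "finite I" "\<And>i. i \<in> I \<Longrightarrow> homogeneous_polynomial d (P i)"
  shows "homogeneous_polynomial d (\<lambda>y. \<Sum>i\<in>I. P i y)"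
  using assms
proof (induction I rule: finite_induct)
  case empty
  show ?case
    unfolding homogeneous_polynomial_def by (intro exI[of _ "\<lambda>_. 0"]) simp
qed (simp add: homogeneous_add)

lemma homogeneous_mult:
  fixes P R :: "real^'n::finite \<Rightarrow> real"
  assumes "homogeneous_polynomial d P" "homogeneous_polynomial e R"
  shows "homogeneous_polynomial (d + e) (\<lambda>y. P y * R y)"
proof -
  define X :: "('n \<Rightarrow> nat) \<Rightarrow> real^'n \<Rightarrow> real"
    where "X m y = (\<Prod>i\<in>UNIV. y $ i ^ m i)" for m y
  obtain a b where
    P: "\<And>y. P y = (\<Sum>m | (\<Sum>i\<in>UNIV. m i) = d. a m * X m y)" and
    R: "\<And>y. R y = (\<Sum>m | (\<Sum>i\<in>UNIV. m i) = e. b m * X m y)"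
    using assms unfolding homogeneous_polynomial_def X_def by blast
  have XX: "X m y * X n y = X (\<lambda>i. m i + n i) y" for m n y
    by (simp add: X_def power_add prod.distrib)
  have "P y * R y = (\<Sum>m | (\<Sum>i\<in>UNIV. m i) = d. \<Sum>n | (\<Sum>i\<in>UNIV. n i) = e.
      (a m * b n) * X (\<lambda>i. m i + n i) y)" for y
    unfolding P R sum_product XX[symmetric] by (simp add: algebra_simps)
  moreover have "homogeneous_polynomial (d + e) (\<lambda>y.
      \<Sum>m | (\<Sum>i\<in>UNIV. m i) = d. \<Sum>n | (\<Sum>i\<in>UNIV. n i) = e.
      (a m * b n) * X (\<lambda>i. m i + n i) y)"
    unfolding X_def
    by (intro homogeneous_sum homogeneous_scale homogeneous_monomial finite_exponents)
      (auto simp: sum.distrib)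
  ultimately show ?thesis by simp
qed

lemma homogeneous_coordinate: "homogeneous_polynomial 1 (\<lambda>y::real^'n::finite. y $ k)"
proof -
  have "(\<Prod>i\<in>UNIV. y $ i ^ (if i = k then 1 else 0)) = y $ k" for y :: "real^'n"
    by (simp add: if_distrib[of "\<lambda>n. _ ^ n"] prod.delta cong: if_cong)
  then show ?thesis
    using homogeneous_monomial[of "\<lambda>i. if i = k then 1 else 0" 1] by (simp add: sum.delta)
qed

lemma homogeneous_coordinate_product:
  "homogeneous_polynomial 2 (\<lambda>y::real^'n::finite. y $ k * y $ l)"
  using homogeneous_mult[OF homogeneous_coordinate homogeneous_coordinate, of k l]
  by (simp add: numeral_2_eq_2)

lemma homogeneous_det:
  fixes M :: "real^3 \<Rightarrow> real^3^3"
  assumes "\<And>i j. homogeneous_polynomial 2 (\<lambda>y. M y $ i $ j)"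
  shows "homogeneous_polynomial 6 (\<lambda>y. det (M y))"
proof -
  have "homogeneous_polynomial (2 + 2 + 2)
      (\<lambda>y. M y $ i $ j * M y $ k $ l * M y $ m $ n)" for i j k l m n
    by (intro homogeneous_mult assms)
  then show ?thesis
    unfolding det_3 by (intro homogeneous_add homogeneous_diff) simp_all
qed

section \<open>Monotonicity of the determinant\<close>

lemma nonneg_affine_slope_zero:
  fixes b c :: real
  assumes "\<And>x. 0 \<le> 2 * b * x + c"
  shows "b = 0"
proof (rule ccontr)
  assume "b \<noteq> 0"
  then show False
    using assms[of "(- c - 1) / (2 * b)"] by simp
qed

text \<open>Both sides are the minima over \<open>x\<close> of the two quadratics: the value of the larger quadratic at its
  own minimiser bounds the smaller quadratic there, hence its minimum.\<close>
lemma completed_square_mono: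
  fixes a b c a' b' c' :: real
  assumes "0 < a" "0 < a'" "\<And>x. a * x\<^sup>2 + 2 * b * x + c \<le> a' * x\<^sup>2 + 2 * b' * x + c'"
  shows "c - b\<^sup>2 / a \<le> c' - b'\<^sup>2 / a'"
proof -
  have "c - b\<^sup>2 / a \<le> a * x\<^sup>2 + 2 * b * x + c" for x
  proof -
    have "a * x\<^sup>2 + 2 * b * x + c - (c - b\<^sup>2 / a) = (a * x + b)\<^sup>2 / a"
      using assms(1) by (simp add: field_simps power2_eq_square)
    moreover have "(a * x + b)\<^sup>2 / a \<ge> 0" using assms(1) by simp
    ultimately show ?thesis by linarith
  qed
  also have "a * (- b' / a')\<^sup>2 + 2 * b * (- b' / a') + c \<le> c' - b'\<^sup>2 / a'"
    using assms(3)[of "- b' / a'"] assms(2) by (simp add: field_simps power2_eq_square)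
  finally show ?thesis .
qed

lemma completed_square_nonneg:
  fixes a b c :: real
  assumes "0 < a" "\<And>x. 0 \<le> a * x\<^sup>2 + 2 * b * x + c"
  shows "0 \<le> c - b\<^sup>2 / a"
  using assms(2)[of "- b / a"] assms(1) by (simp add: field_simps power2_eq_square)

lemma det2_nonneg:
  fixes p r s :: real
  assumes "\<And>x y. 0 \<le> p * x\<^sup>2 + 2 * r * x * y + s * y\<^sup>2"
  shows "0 \<le> p * s - r\<^sup>2"
proof (cases "p = 0")
  case True
  then have "r = 0" using assms[of _ 1] nonneg_affine_slope_zero[of r s] by simp
  then show ?thesis using True by simp
next
  case False
  then have p: "0 < p" using assms[of 1 0] by simp
  have "0 \<le> s - r\<^sup>2 / p" using completed_square_nonneg[OF p, of r s] assms[of _ 1] by simp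
  then have "0 \<le> p * (s - r\<^sup>2 / p)" using p by simp
  then show ?thesis using p by (simp add: right_diff_distrib)
qed

text \<open>The determinant factors as the leading entry times the Schur complement.  Both factors grow with
  the form: the latter is a minimum over one variable.  A vanishing leading entry has to be treated
  apart.\<close>
lemma det2_mono:
  fixes p r s :: real
  assumes nn: "\<And>x y. 0 \<le> p * x\<^sup>2 + 2 * r * x * y + s * y\<^sup>2"
    and le: "\<And>x y. p * x\<^sup>2 + 2 * r * x * y + s * y\<^sup>2 \<le> p' * x\<^sup>2 + 2 * r' * x * y + s' * y\<^sup>2"
  shows "p * s - r\<^sup>2 \<le> p' * s' - r'\<^sup>2"
proof (cases "p = 0")
  case True
  then have "p * s - r\<^sup>2 \<le> 0" by simp
  also have "0 \<le> p' * s' - r'\<^sup>2" by (rule det2_nonneg) (use nn le in \<open>blast intro: order_trans\<close>)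
  finally show ?thesis .
next
  case False
  then have p: "0 < p" using nn[of 1 0] by simp
  have pp: "p \<le> p'" using le[of 1 0] by simp
  then have p': "0 < p'" using p by simp
  have "0 \<le> s - r\<^sup>2 / p" using completed_square_nonneg[OF p, of r s] nn[of _ 1] by simp
  moreover have "s - r\<^sup>2 / p \<le> s' - r'\<^sup>2 / p'"
    using completed_square_mono[OF p p', of r s r' s'] le[of _ 1] by simp
  ultimately have "p * (s - r\<^sup>2 / p) \<le> p' * (s' - r'\<^sup>2 / p')"
    using pp p by (intro mult_mono) auto
  then show ?thesis using p p' by (simp add: right_diff_distrib)
qed

lemma transpose_entries:
  assumes "transpose A = A"
  shows "A $ i $ j = A $ j $ i"
proof -
  have "transpose A $ i $ j = A $ j $ i" by (simp add: transpose_def)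
  then show ?thesis by (simp add: assms)
qed

lemma det_sym3:
  fixes A :: "real^3^3"
  assumes "transpose A = A"
  shows "det A = A$1$1 * A$2$2 * A$3$3 + 2 * A$1$2 * A$1$3 * A$2$3
      - A$1$1 * (A$2$3)\<^sup>2 - A$2$2 * (A$1$3)\<^sup>2 - A$3$3 * (A$1$2)\<^sup>2"
proof -
  note sym = transpose_entries[OF assms, of 2 1] transpose_entries[OF assms, of 3 1]
    transpose_entries[OF assms, of 3 2]
  show ?thesis
    by (simp add: det_3 sym power2_eq_square algebra_simps)
qed

lemma quadratic_sym3:
  fixes A :: "real^3^3"
  assumes "transpose A = A"
  shows "(vector [x, y, z] v* A) \<bullet> vector [x, y, z] = A$1$1 * x\<^sup>2 + 2 * (A$1$2 * y + A$1$3 * z) * x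
      + (A$2$2 * y\<^sup>2 + 2 * A$2$3 * y * z + A$3$3 * z\<^sup>2)"
proof -
  note sym = transpose_entries[OF assms, of 2 1] transpose_entries[OF assms, of 3 1]
    transpose_entries[OF assms, of 3 2]
  show ?thesis
    by (simp add: sym vector_matrix_mult_def inner_vec_def sum_3 power2_eq_square algebra_simps)
qed

lemma det_schur:
  fixes A :: "real^3^3"
  assumes "transpose A = A" "A$1$1 \<noteq> 0"
  shows "det A = A$1$1 * ((A$2$2 - (A$1$2)\<^sup>2 / A$1$1) * (A$3$3 - (A$1$3)\<^sup>2 / A$1$1)
      - (A$2$3 - A$1$2 * A$1$3 / A$1$1)\<^sup>2)"
proof -
  have schur: "a * ((b - d\<^sup>2 * i) * (c - e\<^sup>2 * i) - (f - d * e * i)\<^sup>2)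
      = a * (b * c - f\<^sup>2) - (a * i) * (b * e\<^sup>2 + c * d\<^sup>2 - 2 * d * e * f)" for a b c d e f i :: real
    by (simp add: power2_eq_square algebra_simps)
  show ?thesis
    unfolding det_sym3[OF assms(1)] divide_inverse schur using assms(2)
    by (simp add: algebra_simps)
qed

text \<open>The binary form of the Schur complement is the result of minimising the ternary form over its first
  variable; this is what carries monotonicity from the \<open>2 \<times> 2\<close> case to the \<open>3 \<times> 3\<close> case.\<close>
lemma quadratic_schur:
  fixes a d e b f c y z :: real
  shows "(b - d\<^sup>2 / a) * y\<^sup>2 + 2 * (f - d * e / a) * y * z + (c - e\<^sup>2 / a) * z\<^sup>2
    = (b * y\<^sup>2 + 2 * f * y * z + c * z\<^sup>2) - (d * y + e * z)\<^sup>2 / a"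
  by (simp add: divide_inverse power2_eq_square algebra_simps)

lemma det3_nonneg:
  fixes A :: "real^3^3"
  assumes sym: "transpose A = A" and nn: "\<And>x. 0 \<le> (x v* A) \<bullet> x"
  shows "0 \<le> det A"
proof (cases "A$1$1 = 0")
  case True
  note q = nn[of "vector [_, _, _]", unfolded quadratic_sym3[OF sym]]
  have "A$1$2 = 0"
    using q[of _ 1 0] nonneg_affine_slope_zero[of "A$1$2" "A$2$2"] True by simp
  moreover have "A$1$3 = 0"
    using q[of _ 0 1] nonneg_affine_slope_zero[of "A$1$3" "A$3$3"] True by simp
  ultimately show ?thesis using True by (simp add: det_sym3[OF sym])
next
  case False
  note q = nn[of "vector [_, _, _]", unfolded quadratic_sym3[OF sym]]
  have a: "0 < A$1$1" using False q[of 1 0 0] by simp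
  show ?thesis
    unfolding det_schur[OF sym False]
    using a completed_square_nonneg[OF a q]
    by (intro mult_nonneg_nonneg det2_nonneg) (simp_all only: quadratic_schur less_imp_le)
qed

lemma det3_mono:
  fixes A B :: "real^3^3"
  assumes symA: "transpose A = A" and symB: "transpose B = B"
    and nn: "\<And>x. 0 \<le> (x v* A) \<bullet> x" and le: "\<And>x. (x v* A) \<bullet> x \<le> (x v* B) \<bullet> x"
  shows "det A \<le> det B"
proof (cases "A$1$1 = 0")
  case True
  note q = nn[of "vector [_, _, _]", unfolded quadratic_sym3[OF symA]]
  have "A$1$2 = 0"
    using q[of _ 1 0] nonneg_affine_slope_zero[of "A$1$2" "A$2$2"] True by simp
  moreover have "A$1$3 = 0"
    using q[of _ 0 1] nonneg_affine_slope_zero[of "A$1$3" "A$3$3"] True by simp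
  ultimately have "det A = 0" using True by (simp add: det_sym3[OF symA])
  also have "0 \<le> det B"
    by (rule det3_nonneg[OF symB]) (use nn le in \<open>blast intro: order_trans\<close>)
  finally show ?thesis .
next
  case False
  note q = nn[of "vector [_, _, _]", unfolded quadratic_sym3[OF symA]]
  note l = le[of "vector [_, _, _]", unfolded quadratic_sym3[OF symA] quadratic_sym3[OF symB]]
  have a: "0 < A$1$1" using False q[of 1 0 0] by simp
  have ab: "A$1$1 \<le> B$1$1" using l[of 1 0 0] by simp
  then have b: "0 < B$1$1" using a by simp
  then have nb: "B$1$1 \<noteq> 0" by simp
  show ?thesis
    unfolding det_schur[OF symA False] det_schur[OF symB nb]
    using a b ab completed_square_nonneg[OF a q] completed_square_mono[OF a b l]
    by (intro mult_mono det2_nonneg det2_mono) (simp_all only: quadratic_schur less_imp_le)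
qed

section \<open>The acoustic matrix of an orthotropic form\<close>

text \<open>Only the entries of \<open>C\<close> on and above the diagonal occur, so the matrix is symmetric for every
  \<open>C\<close>.\<close>
definition acoustic :: "real^3^3 \<Rightarrow> real \<Rightarrow> real \<Rightarrow> real \<Rightarrow> real^3 \<Rightarrow> real^3^3"
  where "acoustic C c44 c55 c66 y = vector [
      vector [C$1$1 * (y$1 * y$1) + c66 * (y$2 * y$2) + c55 * (y$3 * y$3),
              (C$1$2 + c66) * (y$1 * y$2), (C$1$3 + c55) * (y$1 * y$3)],
      vector [(C$1$2 + c66) * (y$1 * y$2),
              c66 * (y$1 * y$1) + C$2$2 * (y$2 * y$2) + c44 * (y$3 * y$3),
              (C$2$3 + c44) * (y$2 * y$3)],
      vector [(C$1$3 + c55) * (y$1 * y$3), (C$2$3 + c44) * (y$2 * y$3),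
              c55 * (y$1 * y$1) + c44 * (y$2 * y$2) + C$3$3 * (y$3 * y$3)]]"

lemma transpose_acoustic: "transpose (acoustic C c44 c55 c66 y) = acoustic C c44 c55 c66 y"
  by (simp add: acoustic_def transpose_def vec_eq_iff forall_3)

lemma orthotropic_form_tensor:
  assumes "\<And>i j. C $ i $ j = C $ j $ i"
  shows "orthotropic_form C c44 c55 c66 (x \<otimes>\<^sub>t y) = (x v* acoustic C c44 c55 c66 y) \<bullet> x"
  using assms[of 2 1] assms[of 3 1] assms[of 3 2]
  by (simp add: acoustic_def orthotropic_form_def tensor_def vector_matrix_mult_def inner_vec_def
      sum_3 power2_eq_square algebra_simps)

lemma is_acoustic_matrix_acoustic:
  assumes "\<And>i j. C $ i $ j = C $ j $ i"
  shows "is_acoustic_matrix (orthotropic_form C c44 c55 c66) (acoustic C c44 c55 c66)"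
proof -
  have "quadratic_form (\<lambda>y::real^3. c * (y $ k * y $ l))" for c k l
    using quadratic_form_prod[of "\<lambda>y::real^3. c * y $ k" "\<lambda>y. y $ l"]
    by (simp add: linear_iff algebra_simps)
  then have "quadratic_form (\<lambda>y. acoustic C c44 c55 c66 y $ i $ j)" for i j
    using exhaust_3[of i] exhaust_3[of j]
    by (auto simp: acoustic_def intro!: quadratic_form_add)
  then show ?thesis
    unfolding is_acoustic_matrix_def
    using transpose_acoustic orthotropic_form_tensor[OF assms] by blast
qed

lemma acoustic_pencil:
  "acoustic (s *\<^sub>R C - t *\<^sub>R D) (s * c44 - t * d44) (s * c55 - t * d55) (s * c66 - t * d66) y
    = s *\<^sub>R acoustic C c44 c55 c66 y - t *\<^sub>R acoustic D d44 d55 d66 y"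
  by (simp add: acoustic_def vec_eq_iff forall_3 algebra_simps)

lemma pencil_entry: "(s *\<^sub>R C - t *\<^sub>R D :: real^3^3) $ i $ j = s * C $ i $ j - t * D $ i $ j"
  by simp

lemma homogeneous_det_acoustic:
  "homogeneous_polynomial 6 (\<lambda>y. det (acoustic C c44 c55 c66 y))"
proof (rule homogeneous_det)
  show "homogeneous_polynomial 2 (\<lambda>y. acoustic C c44 c55 c66 y $ i $ j)" for i j
    using exhaust_3[of i] exhaust_3[of j]
    by (auto simp: acoustic_def intro!: homogeneous_add homogeneous_scale
        homogeneous_coordinate_product)
qed

lemma det_acoustic:
  "det (acoustic C c44 c55 c66 (vector [u, v, w])) =
    (C$1$1 * u\<^sup>2 + c66 * v\<^sup>2 + c55 * w\<^sup>2) *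
      ((c66 * u\<^sup>2 + C$2$2 * v\<^sup>2 + c44 * w\<^sup>2) * (c55 * u\<^sup>2 + c44 * v\<^sup>2 + C$3$3 * w\<^sup>2)
        - ((C$2$3 + c44) * (v * w))\<^sup>2)
    + 2 * ((C$1$2 + c66) * (C$1$3 + c55) * (C$2$3 + c44)) * (u * v * w)\<^sup>2
    - (c66 * u\<^sup>2 + C$2$2 * v\<^sup>2 + c44 * w\<^sup>2) * ((C$1$3 + c55) * (u * w))\<^sup>2
    - (c55 * u\<^sup>2 + c44 * v\<^sup>2 + C$3$3 * w\<^sup>2) * ((C$1$2 + c66) * (u * v))\<^sup>2"
  unfolding det_sym3[OF transpose_acoustic]
  by (simp add: acoustic_def power2_eq_square algebra_simps)

text \<open>The two middle coefficients are mixed discriminants; only their independence of \<open>s\<close> and \<open>t\<close>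
  matters.\<close>
lemma det_pencil_cubic:
  fixes A B :: "real^3^3"
  shows "\<exists>k1 k2. \<forall>s t. det (s *\<^sub>R A - t *\<^sub>R B)
    = s^3 * det A + s\<^sup>2 * t * k1 + s * t\<^sup>2 * k2 - t^3 * det B"
proof -
  define d :: "real^3 \<Rightarrow> real^3 \<Rightarrow> real^3 \<Rightarrow> real"
    where "d x y z = det (vector [x, y, z])" for x y z
  have d: "d x y z = x$1 * (y$2 * z$3 - y$3 * z$2) + x$2 * (y$3 * z$1 - y$1 * z$3)
      + x$3 * (y$1 * z$2 - y$2 * z$1)" for x y z
    by (simp add: d_def det_3 algebra_simps)
  have det_rows: "det M = d (M$1) (M$2) (M$3)" for M
    by (simp add: d det_3 algebra_simps)
  have linear: "d (s *\<^sub>R x - t *\<^sub>R x') y z = s * d x y z - t * d x' y z"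
      "d y (s *\<^sub>R x - t *\<^sub>R x') z = s * d y x z - t * d y x' z"
      "d y z (s *\<^sub>R x - t *\<^sub>R x') = s * d y z x - t * d y z x'" for s t x x' y z
    by (simp_all add: d algebra_simps)
  show ?thesis
    by (intro exI[of _ "- (d (B$1) (A$2) (A$3) + d (A$1) (B$2) (A$3) + d (A$1) (A$2) (B$3))"]
        exI[of _ "d (A$1) (B$2) (B$3) + d (B$1) (A$2) (B$3) + d (B$1) (B$2) (A$3)"] allI)
      (simp add: det_rows linear power2_eq_square power3_eq_cube algebra_simps)
qed

lemma cubic_vanishing_on_unit_interval:
  fixes k0 k1 k2 k3 :: real
  assumes "\<And>t. 0 \<le> t \<Longrightarrow> t \<le> 1 \<Longrightarrow> k0 + t * k1 + t\<^sup>2 * k2 + t^3 * k3 = 0"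
  shows "k0 = 0 \<and> k1 = 0 \<and> k2 = 0 \<and> k3 = 0"
  using assms[of 0] assms[of "1/3"] assms[of "2/3"] assms[of 1]
  by (simp add: power2_eq_square power3_eq_cube)

lemma det_acoustic_coordinate_planes:
  "det (acoustic C c44 c55 c66 (vector [u, v, 0])) = (c55 * u\<^sup>2 + c44 * v\<^sup>2) *
    ((C$1$1 * u\<^sup>2 + c66 * v\<^sup>2) * (c66 * u\<^sup>2 + C$2$2 * v\<^sup>2) - ((C$1$2 + c66) * (u * v))\<^sup>2)"
  "det (acoustic C c44 c55 c66 (vector [u, 0, v])) = (c66 * u\<^sup>2 + c44 * v\<^sup>2) *
    ((C$1$1 * u\<^sup>2 + c55 * v\<^sup>2) * (c55 * u\<^sup>2 + C$3$3 * v\<^sup>2) - ((C$1$3 + c55) * (u * v))\<^sup>2)"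
  "det (acoustic C c44 c55 c66 (vector [0, u, v])) = (c66 * u\<^sup>2 + c55 * v\<^sup>2) *
    ((C$2$2 * u\<^sup>2 + c44 * v\<^sup>2) * (c44 * u\<^sup>2 + C$3$3 * v\<^sup>2) - ((C$2$3 + c44) * (u * v))\<^sup>2)"
  by (simp_all add: det_acoustic algebra_simps)

lemma det_acoustic_axes:
  "det (acoustic C c44 c55 c66 (vector [1, 0, 0])) = C$1$1 * (c66 * c55)"
  "det (acoustic C c44 c55 c66 (vector [0, 1, 0])) = C$2$2 * (c66 * c44)"
  "det (acoustic C c44 c55 c66 (vector [0, 0, 1])) = C$3$3 * (c55 * c44)"
  by (simp_all add: det_acoustic)

lemma orthotropic_form_pencil:
  "orthotropic_form (s *\<^sub>R C - t *\<^sub>R D) (s * c44 - t * d44) (s * c55 - t * d55) (s * c66 - t * d66) \<xi>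
    = s * orthotropic_form C c44 c55 c66 \<xi> - t * orthotropic_form D d44 d55 d66 \<xi>"
  by (simp add: orthotropic_form_def sum_3 algebra_simps)

section \<open>Algebraic consequences of a constant spectrum\<close>

text \<open>The hypothesis is the constancy of the spectrum along a coordinate plane through the axis
  \<open>v = 0\<close>: on the left the pencil has the scalar factor belonging to the coordinate normal to the
  plane, on the right stands its value on the axis, a product of three linear factors.  Inserting
  the root of the scalar factor leaves a polynomial identity in \<open>v\<close>.  The last factor, the
  determinant for the larger form, is not the zero polynomial, so one linear factor vanishes for all
  \<open>v\<close>.  Each of them does so only if \<open>p q' = q p'\<close>.\<close>
lemma plane_ratio:
  fixes p p' q q' a a' c c' b k :: real
  assumes pos: "0 < a" "0 < c" "0 < p"
    and spectrum: "\<And>s t v. ((s * p - t * p') + (s * q - t * q') * v\<^sup>2) * E s t v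
      = (s * a - t * a') * (s * c - t * c') * (s * p - t * p') *
        ((p + q * v\<^sup>2) * ((a + c * v\<^sup>2) * (c + b * v\<^sup>2) - (k * v)\<^sup>2))"
  shows "p * q' = q * p'"
proof -
  \<comment> \<open>the linear factor \<open>s x - t x'\<close> at the root \<open>s = p' + q' v\<^sup>2\<close>, \<open>t = p + q v\<^sup>2\<close>\<close>
  define F where "F x x' = [: x * p' - x' * p, 0, x * q' - x' * q :]" for x x'
  define L where "L = [: p, 0, q :]"
  define B where "B = [: a * c, 0, a * b + c * c - k * k, 0, c * b :]"
  have "poly (F a a' * F c c' * F p p' * (L * B)) v = 0" for v
    using spectrum[of "p' + q' * v\<^sup>2" "p + q * v\<^sup>2" v]
    by (simp add: F_def L_def B_def power2_eq_square algebra_simps)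
  then have "F a a' * F c c' * F p p' * (L * B) = 0"
    using poly_all_0_iff_0 by blast
  moreover have "L \<noteq> 0" "B \<noteq> 0"
    using pos by (simp_all add: L_def B_def)
  ultimately have "F a a' = 0 \<or> F c c' = 0 \<or> F p p' = 0" by auto
  moreover have "p * q' = q * p'" if "0 < x" "F x x' = 0" for x x'
  proof -
    have "x * p' = x' * p" "x * q' = x' * q" using that(2) by (simp_all add: F_def)
    then have "x * (p * q') = x * (q * p')" by (metis mult.left_commute mult.commute)
    then show ?thesis using that(1) by simp
  qed
  ultimately show ?thesis using pos by blast
qed

text \<open>The spectrum of the shifted matrix is \<open>\<beta>, 0, 0\<close>, so the block that remains on a coordinate
  plane after the scalar factor \<open>\<sigma> g\<close> is split off has eigenvalues \<open>0\<close> and \<open>\<beta>\<close>.  Two nonzero values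
  of \<open>\<sigma>\<close>, namely \<open>\<plusminus>\<beta>\<close>, or \<open>\<plusminus>1\<close> if \<open>\<beta> = 0\<close>, contain all the information.  The value \<open>\<sigma> = 0\<close> says
  nothing, because the scalar factor vanishes there.\<close>
lemma plane_block:
  fixes g a b c h n \<beta> :: real
  assumes "g \<noteq> 0"
    and spectrum: "\<And>\<sigma>. (\<sigma> * g) *
        ((\<sigma> * a - \<beta> * a + \<sigma> * c) * (\<sigma> * c + (\<sigma> * b - \<beta> * b)) - (\<sigma> * h - n + \<sigma> * c)\<^sup>2)
      = \<sigma>\<^sup>2 * (\<sigma> - \<beta>) * (g * ((a + c) * (c + b) - (h + c)\<^sup>2))"
  shows "\<beta> = 0 \<Longrightarrow> n = 0"
    and "\<beta> \<noteq> 0 \<Longrightarrow> (n / \<beta>)\<^sup>2 = a * b \<and> (h + c - n / \<beta>)\<^sup>2 = c\<^sup>2"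
proof -
  have block: "(\<sigma> * (a + c) - \<beta> * a) * (\<sigma> * (b + c) - \<beta> * b) - (\<sigma> * (h + c) - n)\<^sup>2
      = \<sigma> * (\<sigma> - \<beta>) * ((a + c) * (b + c) - (h + c)\<^sup>2)" if "\<sigma> \<noteq> 0" for \<sigma>
  proof -
    have "(\<sigma> * g) * ((\<sigma> * (a + c) - \<beta> * a) * (\<sigma> * (b + c) - \<beta> * b) - (\<sigma> * (h + c) - n)\<^sup>2)
      = (\<sigma> * g) * (\<sigma> * (\<sigma> - \<beta>) * ((a + c) * (b + c) - (h + c)\<^sup>2))"
      using spectrum[of \<sigma>] by (simp add: power2_eq_square algebra_simps)
    then show ?thesis using that assms(1) by simp
  qed
  show "n = 0" if "\<beta> = 0"
    using block[of 1] block[of "-1"] that by (simp add: power2_eq_square algebra_simps)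
  assume nz: "\<beta> \<noteq> 0"
  define m where "m = n / \<beta>"
  have n: "n = \<beta> * m" using nz by (simp add: m_def)
  have "\<beta>\<^sup>2 * (h + c - m)\<^sup>2 = \<beta>\<^sup>2 * c\<^sup>2"
    using block[OF nz] by (simp add: n power2_eq_square algebra_simps)
  then have 1: "(h + c - m)\<^sup>2 = c\<^sup>2" using nz by simp
  have "\<beta>\<^sup>2 * ((2 * a + c) * (2 * b + c) - (h + c + m)\<^sup>2)
      = \<beta>\<^sup>2 * (2 * ((a + c) * (b + c) - (h + c)\<^sup>2))"
    using block[of "- \<beta>"] nz by (simp add: n power2_eq_square algebra_simps)
  then have "(2 * a + c) * (2 * b + c) - (h + c + m)\<^sup>2 = 2 * ((a + c) * (b + c) - (h + c)\<^sup>2)"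
    using nz by simp
  then have "m\<^sup>2 = a * b" using 1 by (simp add: power2_eq_square algebra_simps)
  then show "(n / \<beta>)\<^sup>2 = a * b \<and> (h + c - n / \<beta>)\<^sup>2 = c\<^sup>2"
    using 1 by (simp add: m_def)
qed

lemma degenerate_square_nonneg:
  fixes c e x y :: real
  assumes "0 < c" "e\<^sup>2 = c\<^sup>2"
  shows "0 \<le> c * (x\<^sup>2 + y\<^sup>2) + 2 * e * (x * y)"
proof -
  have "e = c \<or> e = - c" using assms(2) by (simp add: power2_eq_iff)
  then have "c * (x\<^sup>2 + y\<^sup>2) + 2 * e * (x * y) = c * (x + y)\<^sup>2 \<or>
      c * (x\<^sup>2 + y\<^sup>2) + 2 * e * (x * y) = c * (x - y)\<^sup>2"
    by (auto simp: power2_eq_square algebra_simps)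
  then show ?thesis using assms(1) by auto
qed

text \<open>The matrix of this form has rank one: the \<open>2 \<times> 2\<close> minors on the diagonal vanish by the three
  squares, and the sign condition on \<open>d e f\<close> makes the others vanish.  So \<open>a\<close> times the form is a
  perfect square.\<close>
lemma rank_one_form_nonneg:
  fixes a b c d e f x y z :: real
  assumes "0 < a" "0 < b" "0 < c" "d\<^sup>2 = a * b" "e\<^sup>2 = a * c" "f\<^sup>2 = b * c"
    and "d * e * f = a * b * c"
  shows "0 \<le> a * x\<^sup>2 + b * y\<^sup>2 + c * z\<^sup>2 + 2 * (d * x * y + e * x * z + f * y * z)"
proof -
  have "(b * c) * (d * e) = (d * e * f) * f"
    using assms(6) by (simp add: power2_eq_square algebra_simps)
  also have "\<dots> = (b * c) * (a * f)" using assms(7) by (simp add: algebra_simps)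
  finally have de: "d * e = a * f" using assms(2,3) by simp
  have "(a * x + d * y + e * z)\<^sup>2 = (a * x)\<^sup>2 + d\<^sup>2 * y\<^sup>2 + e\<^sup>2 * z\<^sup>2
      + 2 * (a * x * (d * y) + a * x * (e * z) + (d * e) * (y * z))"
    by (simp add: power2_eq_square algebra_simps)
  also have "\<dots> = a * (a * x\<^sup>2 + b * y\<^sup>2 + c * z\<^sup>2 + 2 * (d * x * y + e * x * z + f * y * z))"
    unfolding de assms(4,5) by (simp add: power2_eq_square algebra_simps)
  finally have "0 \<le> a * (a * x\<^sup>2 + b * y\<^sup>2 + c * z\<^sup>2 + 2 * (d * x * y + e * x * z + f * y * z))"
    by (metis zero_le_power2)
  then show ?thesis using assms(1) by (simp add: zero_le_mult_iff)
qed

section \<open>Forms dominated by an extremal one\<close>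

locale extremal_acoustic =
  fixes C :: "real^3^3" and c44 c55 c66 :: real
  assumes sym: "\<And>i j. C $ i $ j = C $ j $ i"
    and pos: "\<And>i. 0 < C $ i $ i" "0 < c44" "0 < c55" "0 < c66"
    and extremal: "extremal_polynomial 6 (\<lambda>y. det (acoustic C c44 c55 c66 y))"

locale dominated_form = extremal_acoustic +
  fixes D :: "real^3^3" and d44 d55 d66 :: real
  assumes sym_dominated: "\<And>i j. D $ i $ j = D $ j $ i"
    and nonneg: "\<And>x y. 0 \<le> orthotropic_form D d44 d55 d66 (x \<otimes>\<^sub>t y)"
    and dominated: "\<And>x y. orthotropic_form D d44 d55 d66 (x \<otimes>\<^sub>t y)
      \<le> orthotropic_form C c44 c55 c66 (x \<otimes>\<^sub>t y)"
begin

definition pencil_det :: "real \<Rightarrow> real \<Rightarrow> real^3 \<Rightarrow> real"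
  where "pencil_det s t y = det (acoustic (s *\<^sub>R C - t *\<^sub>R D)
    (s * c44 - t * d44) (s * c55 - t * d55) (s * c66 - t * d66) y)"

text \<open>For \<open>t\<close> in the unit interval, \<open>T - t T\<^sub>1\<close> lies between \<open>0\<close> and \<open>T\<close>, so extremality applies to its
  determinant.\<close>
lemma spectrum_constant_unit:
  assumes "0 \<le> t" "t \<le> 1"
  shows "pencil_det 1 t y * det (acoustic C c44 c55 c66 z)
    = pencil_det 1 t z * det (acoustic C c44 c55 c66 y)"
proof -
  define M where "M = acoustic (1 *\<^sub>R C - t *\<^sub>R D)
    (1 * c44 - t * d44) (1 * c55 - t * d55) (1 * c66 - t * d66)"
  have M: "pencil_det 1 t y = det (M y)" for y by (simp add: pencil_det_def M_def)
  have q: "(x v* M y) \<bullet> x = orthotropic_form C c44 c55 c66 (x \<otimes>\<^sub>t y)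
      - t * orthotropic_form D d44 d55 d66 (x \<otimes>\<^sub>t y)" for x y
    unfolding M_def
    by (subst orthotropic_form_tensor[symmetric])
      (simp_all add: sym[symmetric] sym_dominated[symmetric] orthotropic_form_pencil[of 1, simplified])
  have scaled: "0 \<le> t * orthotropic_form D d44 d55 d66 (x \<otimes>\<^sub>t y)"
      "t * orthotropic_form D d44 d55 d66 (x \<otimes>\<^sub>t y) \<le> orthotropic_form D d44 d55 d66 (x \<otimes>\<^sub>t y)" for x y
    using assms nonneg[of x y] by (simp_all add: mult_left_le_one_le)
  have "0 \<le> (x v* M y) \<bullet> x" for x y
    unfolding q using scaled[of x y] dominated[of x y] by linarith
  moreover have "(x v* M y) \<bullet> x \<le> (x v* acoustic C c44 c55 c66 y) \<bullet> x" for x y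
    unfolding q using scaled[of x y] by (simp add: orthotropic_form_tensor[OF sym])
  moreover have "transpose (M y) = M y" for y by (simp add: M_def transpose_acoustic)
  ultimately have "0 \<le> det (M y) \<and> det (M y) \<le> det (acoustic C c44 c55 c66 y)" for y
    by (simp add: det3_nonneg det3_mono transpose_acoustic)
  moreover have "homogeneous_polynomial 6 (\<lambda>y. det (M y))"
    unfolding M_def by (rule homogeneous_det_acoustic)
  ultimately obtain r where "\<And>y. det (M y) = r * det (acoustic C c44 c55 c66 y)"
    using extremal unfolding extremal_polynomial_def by blast
  then show ?thesis by (simp add: M)
qed

text \<open>Both sides are cubic forms in \<open>s\<close> and \<open>t\<close> that agree for \<open>s = 1\<close> and \<open>0 \<le> t \<le> 1\<close>.  The identity is
  needed outside that range, at the generalised eigenvalues.\<close>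
lemma spectrum_constant:
  "pencil_det s t y * det (acoustic C c44 c55 c66 z)
    = pencil_det s t z * det (acoustic C c44 c55 c66 y)"
proof -
  let ?d = "\<lambda>y. det (acoustic C c44 c55 c66 y)"
  have "\<exists>k1 k2 k3. \<forall>s t. pencil_det s t y = s^3 * ?d y + s\<^sup>2 * t * k1 + s * t\<^sup>2 * k2 + t^3 * k3" for y
    unfolding pencil_det_def acoustic_pencil
    using det_pencil_cubic[of "acoustic C c44 c55 c66 y" "acoustic D d44 d55 d66 y"]
    by (metis (no_types, lifting) diff_conv_add_uminus mult_minus_right)
  then obtain k1 k2 k3 where
    k: "\<And>y s t. pencil_det s t y = s^3 * ?d y + s\<^sup>2 * t * k1 y + s * t\<^sup>2 * k2 y + t^3 * k3 y"
    by metis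
  define g where "g k = k y * ?d z - k z * ?d y" for k
  have "g k1 = 0 \<and> g k2 = 0 \<and> g k3 = 0"
    using cubic_vanishing_on_unit_interval[of 0 "g k1" "g k2" "g k3"]
      spectrum_constant_unit[of _ y z]
    by (simp add: k g_def algebra_simps)
  moreover have "pencil_det s t y * ?d z - pencil_det s t z * ?d y
      = s\<^sup>2 * t * g k1 + s * t\<^sup>2 * g k2 + t^3 * g k3"
    by (simp add: k g_def algebra_simps)
  ultimately show ?thesis by simp
qed

text \<open>The scalar factors of \<open>T\<^sub>1\<close> and \<open>T\<close> on the planes \<open>y\<^sub>3 = 0\<close> and \<open>y\<^sub>2 = 0\<close> have a quotient that runs
  through the constant, finite spectrum, and this makes the quotient itself constant.\<close>

lemma shear_ratios: "c55 * d44 = c44 * d55" "c66 * d44 = c44 * d66"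
proof -
  show "c55 * d44 = c44 * d55"
  proof (rule plane_ratio)
    show "((s * c55 - t * d55) + (s * c44 - t * d44) * v\<^sup>2) *
        (((s * C$1$1 - t * D$1$1 + (s * c66 - t * d66) * v\<^sup>2) *
          (s * c66 - t * d66 + (s * C$2$2 - t * D$2$2) * v\<^sup>2)
          - ((s * C$1$2 - t * D$1$2 + (s * c66 - t * d66)) * v)\<^sup>2) * (C$1$1 * (c66 * c55)))
      = (s * C$1$1 - t * D$1$1) * (s * c66 - t * d66) * (s * c55 - t * d55) *
        ((c55 + c44 * v\<^sup>2) * ((C$1$1 + c66 * v\<^sup>2) * (c66 + C$2$2 * v\<^sup>2) - ((C$1$2 + c66) * v)\<^sup>2))"
      for s t v
      using spectrum_constant[of s t "vector [1, v, 0]" "vector [1, 0, 0]"]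
      unfolding pencil_det_def det_acoustic_axes det_acoustic_coordinate_planes by (simp add: mult_ac)
  qed (use pos(1)[of 1] pos(2-) in auto)
  show "c66 * d44 = c44 * d66"
  proof (rule plane_ratio)
    show "((s * c66 - t * d66) + (s * c44 - t * d44) * v\<^sup>2) *
        (((s * C$1$1 - t * D$1$1 + (s * c55 - t * d55) * v\<^sup>2) *
          (s * c55 - t * d55 + (s * C$3$3 - t * D$3$3) * v\<^sup>2)
          - ((s * C$1$3 - t * D$1$3 + (s * c55 - t * d55)) * v)\<^sup>2) * (C$1$1 * (c66 * c55)))
      = (s * C$1$1 - t * D$1$1) * (s * c55 - t * d55) * (s * c66 - t * d66) *
        ((c66 + c44 * v\<^sup>2) * ((C$1$1 + c55 * v\<^sup>2) * (c55 + C$3$3 * v\<^sup>2) - ((C$1$3 + c55) * v)\<^sup>2))"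
      for s t v
      using spectrum_constant[of s t "vector [1, 0, v]" "vector [1, 0, 0]"]
      unfolding pencil_det_def det_acoustic_axes det_acoustic_coordinate_planes by (simp add: mult_ac)
  qed (use pos(1)[of 1] pos(2-) in auto)
qed

text \<open>On the coordinate axis \<open>i\<close> the spectrum consists of \<open>D\<^sub>i\<^sub>i / C\<^sub>i\<^sub>i\<close> and of \<open>\<mu>\<close> twice, so the first
  eigenvalue is the same for all three axes.\<close>
lemma two_eigenvalues:
  obtains \<alpha> \<mu> where "d44 = \<mu> * c44" "d55 = \<mu> * c55" "d66 = \<mu> * c66"
    "\<And>i. D $ i $ i = \<alpha> * C $ i $ i"
proof -
  define \<mu> where "\<mu> = d44 / c44"
  define \<alpha> where "\<alpha> = D$1$1 / C$1$1"
  have \<mu>: "d44 = \<mu> * c44" "d55 = \<mu> * c55" "d66 = \<mu> * c66"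
    using shear_ratios pos by (simp_all add: \<mu>_def field_simps)
  have cancel: "(\<mu> + 1) * c - \<mu> * c = c" for c :: real by (simp add: algebra_simps)
  note p = pos(1)[of 1] pos(1)[of 2] pos(1)[of 3] pos(2-)
  \<comment> \<open>the parameters \<open>(\<mu> + 1, 1)\<close> turn every shear factor into a positive constant\<close>
  have "((\<mu> + 1) * C$1$1 - D$1$1) * (c66 * c55) * (C$2$2 * (c66 * c44))
      = ((\<mu> + 1) * C$2$2 - D$2$2) * (c66 * c44) * (C$1$1 * (c66 * c55))"
    using spectrum_constant[of "\<mu> + 1" 1 "vector [1, 0, 0]" "vector [0, 1, 0]"]
    unfolding pencil_det_def det_acoustic_axes by (simp only: pencil_entry \<mu> cancel mult_1)
  then have "(((\<mu> + 1) * C$1$1 - D$1$1) * C$2$2) * (c66 * c55 * c66 * c44)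
      = (((\<mu> + 1) * C$2$2 - D$2$2) * C$1$1) * (c66 * c55 * c66 * c44)"
    by (simp only: mult_ac)
  then have 2: "D$2$2 = \<alpha> * C$2$2" using p by (simp add: \<alpha>_def field_simps)
  have "((\<mu> + 1) * C$1$1 - D$1$1) * (c66 * c55) * (C$3$3 * (c55 * c44))
      = ((\<mu> + 1) * C$3$3 - D$3$3) * (c55 * c44) * (C$1$1 * (c66 * c55))"
    using spectrum_constant[of "\<mu> + 1" 1 "vector [1, 0, 0]" "vector [0, 0, 1]"]
    unfolding pencil_det_def det_acoustic_axes by (simp only: pencil_entry \<mu> cancel mult_1)
  then have "(((\<mu> + 1) * C$1$1 - D$1$1) * C$3$3) * (c66 * c55 * c55 * c44)
      = (((\<mu> + 1) * C$3$3 - D$3$3) * C$1$1) * (c66 * c55 * c55 * c44)"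
    by (simp only: mult_ac)
  then have 3: "D$3$3 = \<alpha> * C$3$3" using p by (simp add: \<alpha>_def field_simps)
  have 1: "D$1$1 = \<alpha> * C$1$1" using p by (simp add: \<alpha>_def)
  have "D $ i $ i = \<alpha> * C $ i $ i" for i
    using exhaust_3[of i] 1 2 3 by auto
  then show thesis using that \<mu> by blast
qed

text \<open>The spectrum of \<open>T\<^sub>1 - \<mu> T\<close> relative to \<open>T\<close> is \<open>\<alpha> - \<mu>, 0, 0\<close>.\<close>
lemma shifted_spectrum:
  assumes "d44 = \<mu> * c44" "d55 = \<mu> * c55" "d66 = \<mu> * c66" "\<And>i. D $ i $ i = \<alpha> * C $ i $ i"
  shows "det (acoustic (\<sigma> *\<^sub>R C - 1 *\<^sub>R (D - \<mu> *\<^sub>R C)) (\<sigma> * c44) (\<sigma> * c55) (\<sigma> * c66) y)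
    = \<sigma>\<^sup>2 * (\<sigma> - (\<alpha> - \<mu>)) * det (acoustic C c44 c55 c66 y)"
proof -
  have shift: "pencil_det (\<sigma> + \<mu>) 1 y
      = det (acoustic (\<sigma> *\<^sub>R C - 1 *\<^sub>R (D - \<mu> *\<^sub>R C)) (\<sigma> * c44) (\<sigma> * c55) (\<sigma> * c66) y)" for y
    unfolding pencil_det_def by (simp add: assms(1-3) algebra_simps)
  have "pencil_det (\<sigma> + \<mu>) 1 y * (C$1$1 * (c66 * c55))
      = (\<sigma>\<^sup>2 * (\<sigma> - (\<alpha> - \<mu>)) * det (acoustic C c44 c55 c66 y)) * (C$1$1 * (c66 * c55))"
    using spectrum_constant[of "\<sigma> + \<mu>" 1 y "vector [1, 0, 0]"]
    unfolding shift det_acoustic_axes by (simp add: assms(4) power2_eq_square algebra_simps)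
  then show ?thesis using pos(1)[of 1] pos(2-) by (simp add: shift)
qed

text \<open>For \<open>\<beta> \<noteq> 0\<close> these equations say that \<open>(T\<^sub>1 - \<mu> T) / \<beta>\<close> is a matrix \<open>m\<^sub>i\<^sub>j y\<^sub>i y\<^sub>j\<close> of rank one with the
  diagonal \<open>C\<^sub>i\<^sub>i y\<^sub>i\<^sup>2\<close>, and that what is left of \<open>Q\<close> after its removal is a sum of degenerate
  forms in two of the products \<open>x\<^sub>i y\<^sub>j\<close>.  The three coordinate planes give the squares; the sign of
  the product \<open>m\<^sub>1\<^sub>2 m\<^sub>1\<^sub>3 m\<^sub>2\<^sub>3\<close> comes from the vanishing determinant at \<open>y = (1, 1, 1)\<close>.\<close>
lemma eigenvalue_blocks:
  assumes d: "d44 = \<mu> * c44" "d55 = \<mu> * c55" "d66 = \<mu> * c66" "\<And>i. D $ i $ i = \<alpha> * C $ i $ i"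
  defines "\<beta> \<equiv> \<alpha> - \<mu>" and "n \<equiv> \<lambda>i j. D $ i $ j - \<mu> * C $ i $ j"
  shows "\<beta> = 0 \<Longrightarrow> n 1 2 = 0 \<and> n 1 3 = 0 \<and> n 2 3 = 0"
    and "\<beta> \<noteq> 0 \<Longrightarrow> (n 1 2 / \<beta>)\<^sup>2 = C$1$1 * C$2$2 \<and> (C$1$2 + c66 - n 1 2 / \<beta>)\<^sup>2 = c66\<^sup>2"
    and "\<beta> \<noteq> 0 \<Longrightarrow> (n 1 3 / \<beta>)\<^sup>2 = C$1$1 * C$3$3 \<and> (C$1$3 + c55 - n 1 3 / \<beta>)\<^sup>2 = c55\<^sup>2"
    and "\<beta> \<noteq> 0 \<Longrightarrow> (n 2 3 / \<beta>)\<^sup>2 = C$2$2 * C$3$3 \<and> (C$2$3 + c44 - n 2 3 / \<beta>)\<^sup>2 = c44\<^sup>2"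
    and "\<beta> \<noteq> 0 \<Longrightarrow> (n 1 2 / \<beta>) * (n 1 3 / \<beta>) * (n 2 3 / \<beta>) = C$1$1 * C$2$2 * C$3$3"
proof -
  note spectrum = shifted_spectrum[OF d, folded \<beta>_def]
  have diag: "(\<sigma> *\<^sub>R C - 1 *\<^sub>R (D - \<mu> *\<^sub>R C)) $ i $ i = \<sigma> * C $ i $ i - \<beta> * C $ i $ i" for \<sigma> i
    by (simp add: d(4) \<beta>_def algebra_simps)
  have offdiag: "(\<sigma> *\<^sub>R C - 1 *\<^sub>R (D - \<mu> *\<^sub>R C)) $ i $ j = \<sigma> * C $ i $ j - n i j" for \<sigma> i j
    by (simp add: n_def)
  note entries = diag[of _ 1] diag[of _ 2] diag[of _ 3] offdiag[of _ 1 2] offdiag[of _ 1 3]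
    offdiag[of _ 2 3]
  note planes = det_acoustic_coordinate_planes entries power_one mult_1_right
    distrib_left[symmetric]
  have nz: "c55 + c44 \<noteq> 0" "c66 + c44 \<noteq> 0" "c66 + c55 \<noteq> 0" using pos(2-) by auto
  note block12 = plane_block[OF nz(1) spectrum[of _ "vector [1, 1, 0]", unfolded planes]]
  note block13 = plane_block[OF nz(2) spectrum[of _ "vector [1, 0, 1]", unfolded planes]]
  note block23 = plane_block[OF nz(3) spectrum[of _ "vector [0, 1, 1]", unfolded planes]]
  show "\<beta> = 0 \<Longrightarrow> n 1 2 = 0 \<and> n 1 3 = 0 \<and> n 2 3 = 0"
    using block12(1) block13(1) block23(1) by blast
  show m12: "\<beta> \<noteq> 0 \<Longrightarrow> (n 1 2 / \<beta>)\<^sup>2 = C$1$1 * C$2$2 \<and> (C$1$2 + c66 - n 1 2 / \<beta>)\<^sup>2 = c66\<^sup>2"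
    by (rule block12(2))
  show m13: "\<beta> \<noteq> 0 \<Longrightarrow> (n 1 3 / \<beta>)\<^sup>2 = C$1$1 * C$3$3 \<and> (C$1$3 + c55 - n 1 3 / \<beta>)\<^sup>2 = c55\<^sup>2"
    by (rule block13(2))
  show m23: "\<beta> \<noteq> 0 \<Longrightarrow> (n 2 3 / \<beta>)\<^sup>2 = C$2$2 * C$3$3 \<and> (C$2$3 + c44 - n 2 3 / \<beta>)\<^sup>2 = c44\<^sup>2"
    by (rule block23(2))
  assume nz: "\<beta> \<noteq> 0"
  define m where "m i j = n i j / \<beta>" for i j
  have nm: "n i j = \<beta> * m i j" for i j using nz by (simp add: m_def)
  have squares: "(m 1 2)\<^sup>2 = C$1$1 * C$2$2" "(m 1 3)\<^sup>2 = C$1$1 * C$3$3" "(m 2 3)\<^sup>2 = C$2$2 * C$3$3"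
    using m12[OF nz] m13[OF nz] m23[OF nz] by (simp_all add: m_def)
  have "det (acoustic (0 *\<^sub>R C - 1 *\<^sub>R (D - \<mu> *\<^sub>R C)) (0 * c44) (0 * c55) (0 * c66) (vector [1, 1, 1])) = 0"
    unfolding spectrum by simp
  then have "\<beta>^3 * (C$1$1 * C$2$2 * C$3$3 + 2 * (m 1 2 * m 1 3 * m 2 3)
      - C$1$1 * (m 2 3)\<^sup>2 - C$2$2 * (m 1 3)\<^sup>2 - C$3$3 * (m 1 2)\<^sup>2) = 0"
    unfolding det_acoustic entries nm by (simp add: power2_eq_square power3_eq_cube algebra_simps)
  then have "m 1 2 * m 1 3 * m 2 3 = C$1$1 * C$2$2 * C$3$3"
    using nz unfolding squares by (simp add: algebra_simps)
  then show "(n 1 2 / \<beta>) * (n 1 3 / \<beta>) * (n 2 3 / \<beta>) = C$1$1 * C$2$2 * C$3$3"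
    by (simp add: m_def)
qed

end

text \<open>Under these conditions \<open>Q\<close> is a sum of four squares on rank-one matrices, one of which is
  \<open>c\<^sub>6\<^sub>6 (x\<^sub>1 y\<^sub>2 \<plusminus> x\<^sub>2 y\<^sub>1)\<^sup>2\<close>.  This square is an orthotropic form dominated by \<open>Q\<close> with shear
  coefficients \<open>0, 0, c\<^sub>6\<^sub>6\<close>, contrary to \<open>shear_ratios\<close>.\<close>
lemma (in extremal_acoustic) no_rank_one_splitting:
  assumes m: "m12\<^sup>2 = C$1$1 * C$2$2" "m13\<^sup>2 = C$1$1 * C$3$3" "m23\<^sup>2 = C$2$2 * C$3$3"
      "m12 * m13 * m23 = C$1$1 * C$2$2 * C$3$3"
    and e: "(C$1$2 + c66 - m12)\<^sup>2 = c66\<^sup>2" "(C$1$3 + c55 - m13)\<^sup>2 = c55\<^sup>2"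
      "(C$2$3 + c44 - m23)\<^sup>2 = c44\<^sup>2"
  shows False
proof -
  \<comment> \<open>with \<open>h + c66\<close> as mixed coefficient, \<open>D\<close> and \<open>c66\<close> encode the square above\<close>
  define h where "h = C$1$2 - m12"
  define D :: "real^3^3" where
    "D = vector [vector [0, h, 0], vector [h, 0, 0], vector [0, 0, 0]]"
  have sym_D: "D $ i $ j = D $ j $ i" for i j
    using exhaust_3[of i] exhaust_3[of j] by (auto simp: D_def)
  have D_form: "orthotropic_form D 0 0 c66 (x \<otimes>\<^sub>t y) =
      c66 * ((x$1 * y$2)\<^sup>2 + (x$2 * y$1)\<^sup>2) + 2 * (C$1$2 + c66 - m12) * ((x$1 * y$2) * (x$2 * y$1))" for x y
    by (simp add: D_def h_def orthotropic_form_def tensor_def sum_3 power2_eq_square algebra_simps)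
  have C_form: "orthotropic_form C c44 c55 c66 (x \<otimes>\<^sub>t y) = orthotropic_form D 0 0 c66 (x \<otimes>\<^sub>t y)
      + (c55 * ((x$1 * y$3)\<^sup>2 + (x$3 * y$1)\<^sup>2) + 2 * (C$1$3 + c55 - m13) * ((x$1 * y$3) * (x$3 * y$1)))
      + (c44 * ((x$2 * y$3)\<^sup>2 + (x$3 * y$2)\<^sup>2) + 2 * (C$2$3 + c44 - m23) * ((x$2 * y$3) * (x$3 * y$2)))
      + (C$1$1 * (x$1 * y$1)\<^sup>2 + C$2$2 * (x$2 * y$2)\<^sup>2 + C$3$3 * (x$3 * y$3)\<^sup>2
        + 2 * (m12 * (x$1 * y$1) * (x$2 * y$2) + m13 * (x$1 * y$1) * (x$3 * y$3)
          + m23 * (x$2 * y$2) * (x$3 * y$3)))" for x y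
    unfolding D_form using sym[of 2 1] sym[of 3 1] sym[of 3 2]
    by (simp add: orthotropic_form_def tensor_def sum_3 power2_eq_square algebra_simps)
  interpret shear: dominated_form C c44 c55 c66 D 0 0 c66
  proof
    show "D $ i $ j = D $ j $ i" for i j by (rule sym_D)
    show "0 \<le> orthotropic_form D 0 0 c66 (x \<otimes>\<^sub>t y)" for x y
      unfolding D_form by (rule degenerate_square_nonneg[OF pos(4) e(1)])
    show "orthotropic_form D 0 0 c66 (x \<otimes>\<^sub>t y) \<le> orthotropic_form C c44 c55 c66 (x \<otimes>\<^sub>t y)" for x y
      unfolding C_form
      using degenerate_square_nonneg[OF pos(3) e(2), of "x$1 * y$3" "x$3 * y$1"]
        degenerate_square_nonneg[OF pos(2) e(3), of "x$2 * y$3" "x$3 * y$2"]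
        rank_one_form_nonneg[OF pos(1) pos(1) pos(1) m, of "x$1 * y$1" "x$2 * y$2" "x$3 * y$3"]
      by linarith
  qed
  show False
    using shear.shear_ratios(2) pos(2-) by simp
qed

lemma (in dominated_form) dominated_proportional:
  "\<exists>\<alpha>. D = \<alpha> *\<^sub>R C \<and> d44 = \<alpha> * c44 \<and> d55 = \<alpha> * c55 \<and> d66 = \<alpha> * c66"
proof -
  obtain \<alpha> \<mu> where d: "d44 = \<mu> * c44" "d55 = \<mu> * c55" "d66 = \<mu> * c66"
    "\<And>i. D $ i $ i = \<alpha> * C $ i $ i"
    using two_eigenvalues by blast
  have "\<alpha> = \<mu>"
  proof (rule ccontr)
    assume "\<alpha> \<noteq> \<mu>"
    then have nz: "\<alpha> - \<mu> \<noteq> 0" by simp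
    show False
      using eigenvalue_blocks(2-5)[OF d nz] by (intro no_rank_one_splitting) blast+
  qed
  then have "D$1$2 = \<alpha> * C$1$2" "D$1$3 = \<alpha> * C$1$3" "D$2$3 = \<alpha> * C$2$3"
    using eigenvalue_blocks(1)[OF d] by simp_all
  then have "D $ i $ j = \<alpha> * C $ i $ j" for i j
    using d(4) exhaust_3[of i] exhaust_3[of j] sym[of 2 1] sym[of 3 1] sym[of 3 2]
      sym_dominated[of 2 1] sym_dominated[of 3 1] sym_dominated[of 3 2] by auto
  then show ?thesis
    using d \<open>\<alpha> = \<mu>\<close> by (intro exI[of _ \<alpha>]) (simp add: vec_eq_iff)
qed

theorem theorem3p1:
  fixes C :: "real^3^3" and c44 c55 c66 :: real
    and Q :: "real^3^3 \<Rightarrow> real" and T :: "real^3 \<Rightarrow> real^3^3"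
  assumes "\<And>\<xi>. Q \<xi> = (\<Sum>i\<in>UNIV. \<Sum>j\<in>UNIV. C $ i $ j * \<xi> $ i $ i * \<xi> $ j $ j)
      + c44 * (\<xi> $ 2 $ 3 + \<xi> $ 3 $ 2)\<^sup>2
      + c55 * (\<xi> $ 1 $ 3 + \<xi> $ 3 $ 1)\<^sup>2
      + c66 * (\<xi> $ 1 $ 2 + \<xi> $ 2 $ 1)\<^sup>2"
    and "\<And>i j. C $ i $ j = C $ j $ i"
    and "Q \<in> orthotropic_cone"
    and "\<And>i. C $ i $ i > 0" and "c44 > 0" and "c55 > 0" and "c66 > 0"
    and "is_acoustic_matrix Q T"
    and "extremal_polynomial 6 (\<lambda>y. det (T y))"
  shows "cone_extreme_point Q"
proof -
  have Q: "Q = orthotropic_form C c44 c55 c66"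
    using assms(1) by (simp add: fun_eq_iff orthotropic_form_def)
  have T: "T = acoustic C c44 c55 c66"
    using acoustic_matrix_unique[OF assms(8)] is_acoustic_matrix_acoustic[OF assms(2)]
    unfolding Q by blast
  interpret extremal_acoustic C c44 c55 c66
    using assms(2,4-7,9) by unfold_locales (simp_all add: T)
  have "\<exists>\<alpha>\<in>{0..1}. \<forall>\<xi>. Q1 \<xi> = \<alpha> * Q \<xi>"
    if cone: "Q1 \<in> orthotropic_cone"
      and between: "\<forall>x y. 0 \<le> Q1 (x \<otimes>\<^sub>t y) \<and> Q1 (x \<otimes>\<^sub>t y) \<le> Q (x \<otimes>\<^sub>t y)" for Q1
  proof -
    obtain D d44 d55 d66 where D: "\<forall>i j. D $ i $ j = D $ j $ i"
      and Q1: "Q1 = orthotropic_form D d44 d55 d66"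
      using cone unfolding orthotropic_cone_def orthotropic_def by blast
    interpret dominated_form C c44 c55 c66 D d44 d55 d66
      using between D by unfold_locales (simp_all add: Q Q1)
    obtain \<alpha> where "D = \<alpha> *\<^sub>R C" "d44 = \<alpha> * c44" "d55 = \<alpha> * c55" "d66 = \<alpha> * c66"
      using dominated_proportional by blast
    then have scaled: "Q1 \<xi> = \<alpha> * Q \<xi>" for \<xi>
      unfolding Q Q1 by (simp add: orthotropic_form_def sum_3 algebra_simps)
    \<comment> \<open>one rank-one matrix on which \<open>Q\<close> is positive bounds \<open>\<alpha>\<close>\<close>
    have "Q (axis 1 1 \<otimes>\<^sub>t axis 1 1) = C$1$1"
      by (simp add: Q orthotropic_form_def tensor_def sum_3 axis_def)
    then have "0 \<le> \<alpha> * C$1$1" "\<alpha> * C$1$1 \<le> C$1$1"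
      using between unfolding scaled by metis+
    then have "\<alpha> \<in> {0..1}"
      using pos(1)[of 1] by (simp add: zero_le_mult_iff)
    then show ?thesis using scaled by blast
  qed
  then show ?thesis
    using assms(3) unfolding cone_extreme_point_def by blast
qed

end
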